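(* Let $M_\alpha=\begin{pmatrix}\alpha_{11}&\alpha_{12}\\ \alpha_{21}&\alpha_{22}\end{pmatrix}$ have entries $\alpha_{ii'}\ge 0$ and $\det M_\alpha\ne 0$, and set $\kappa_1=\frac{\alpha_{22}-\alpha_{12}}{\det M_\alpha}$, $\kappa_2=\frac{\alpha_{11}-\alpha_{21}}{\det M_\alpha}$. Let $P$ be a nonempty (relatively) open subset of the price space $\mathbb{R}_{\ge 0}^2$. Then the game $M_\alpha$ has a selection $\boldsymbol{\sigma}$ whose restriction $\boldsymbol{\sigma}|_P$ is differentiable and induces negative marginal demand in $P$ if and only if $\kappa_1+\kappa_2<0$ and $$|p^a-p^b|<\min\left\{\frac{1}{|\kappa_1|},\frac{1}{|\kappa_2|}\right\}\quad\text{for every }\mathbf{p}=(p^a,p^b)\in P.$$ Furthermore, for any such selection, both groups split at every $\mathbf{p}\in P$ (i.e. $0<\sigma_i(\mathbf{p})<1$ for $i=1,2$), and the induced demand in $P$ is, for each firm $j\in\{a,b\}$ with $j'$ denoting the other firm, $$D^j(\mathbf{p})=1+\frac{\kappa_1+\kappa_2}{2}\,(p^j-p^{j'}).$$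
   Context: Two firms $a,b$ set prices $\mathbf{p}=(p^a,p^b)\in\mathbb{R}_{\ge0}^2$; then two groups of consumers, each of size $1$, choose a firm (total coverage). Consumer choices are represented by $\boldsymbol{\sigma}=(\sigma_1,\sigma_2)\in[0,1]^2$, where $\sigma_i$ is the proportion of group $i$ choosing $a$. The interaction structure is a real matrix $M_\alpha=(\alpha_{ii'})$ with $\alpha_{ii'}\ge0$ and $\det M_\alpha\neq0$. A member of group $i$ gets $v_i(a;\boldsymbol\sigma)=-p^a+\alpha_{i1}\sigma_1+\alpha_{i2}\sigma_2$ from $a$ and $v_i(b;\boldsymbol\sigma)=-p^b+\alpha_{i1}(1-\sigma_1)+\alpha_{i2}(1-\sigma_2)$ from $b$. Put $$\Delta v_i(\mathbf{p},\boldsymbol\sigma)=-(p^a-p^b)+\alpha_{i1}(2\sigma_1-1)+\alpha_{i2}(2\sigma_2-1).$$ $\boldsymbol\sigma$ represents a second-stage Nash equilibrium at $\mathbf{p}$, written $\boldsymbol\sigma\in E(\mathbf{p})$, if for each $i\in\{1,2\}$: $\sigma_i=1$ implies $\Delta v_i\ge0$; $\sigma_i=0$ implies $\Delta v_i\le0$; $0<\sigma_i<1$ implies $\Delta v_i=0$. A selection is a function $\boldsymbol\sigma:\mathbb{R}_{\ge0}^2\to[0,1]^2$ with $\boldsymbol\sigma(\mathbf{p})\in E(\mathbf{p})$ for all $\mathbf{p}$. It induces demand functions $D^a=\sigma_1+\sigma_2$ and $D^b=2-(\sigma_1+\sigma_2)$. Group $i$ splits at $\mathbf{p}$ if $0<\sigma_i(\mathbf{p})<1$.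 "$\boldsymbol\sigma|_P$ is differentiable" means that $\sigma_1$ and $\sigma_2$ are both differentiable at each point of $P$ (relative to $\mathbb{R}_{\ge0}^2$, i.e. one-sided where a price is $0$). "Induces negative marginal demand in $P$" means $\frac{\partial D^j}{\partial p^j}(\mathbf{p})<0$ for $j=a,b$ and all $\mathbf{p}\in P$. Convention: $1/|\kappa_i|=+\infty$ if $\kappa_i=0$. *)

theory Defs
  imports "HOL-Analysis.Analysis"
begin

datatype firm = Firm_a | Firm_b

instance firm :: finite
proof
  have "(UNIV :: firm set) = {Firm_a, Firm_b}"
    using firm.exhaust by blast
  then show "finite (UNIV :: firm set)"
    by (metis finite.emptyI finite.insertI)
qed

fun other :: "firm \<Rightarrow> firm" where
  "other Firm_a = Firm_b"
| "other Firm_b = Firm_a"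

text \<open>
  Prices are vectors indexed by the firms; consumer choices are vectors indexed by the two
  groups, whose index type is \<^typ>\<open>2\<close> with elements \<open>1\<close> and \<open>2\<close>.
\<close>

definition price_space :: "(real ^ firm) set" where
  "price_space = {p. \<forall>j. 0 \<le> p $ j}"

definition payoff :: "real ^ 2 ^ 2 \<Rightarrow> real ^ firm \<Rightarrow> 2 \<Rightarrow> firm \<Rightarrow> real ^ 2 \<Rightarrow> real" where
  "payoff M p i j s = (case j of
      Firm_a \<Rightarrow> - p $ Firm_a + M $ i $ 1 * s $ 1 + M $ i $ 2 * s $ 2
    | Firm_b \<Rightarrow> - p $ Firm_b + M $ i $ 1 * (1 - s $ 1) + M $ i $ 2 * (1 - s $ 2))"

definition delta_v :: "real ^ 2 ^ 2 \<Rightarrow> 2 \<Rightarrow> real ^ firm \<Rightarrow> real ^ 2 \<Rightarrow> real" where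
  "delta_v M i p s = - (p $ Firm_a - p $ Firm_b)
     + M $ i $ 1 * (2 * s $ 1 - 1) + M $ i $ 2 * (2 * s $ 2 - 1)"

lemma delta_v_eq_payoff_diff:
  "delta_v M i p s = payoff M p i Firm_a s - payoff M p i Firm_b s"
  by (simp add: delta_v_def payoff_def algebra_simps)

definition equilibria :: "real ^ 2 ^ 2 \<Rightarrow> real ^ firm \<Rightarrow> (real ^ 2) set" where
  "equilibria M p = {s. \<forall>i. 0 \<le> s $ i \<and> s $ i \<le> 1
      \<and> (s $ i = 1 \<longrightarrow> delta_v M i p s \<ge> 0)
      \<and> (s $ i = 0 \<longrightarrow> delta_v M i p s \<le> 0)
      \<and> (0 < s $ i \<and> s $ i < 1 \<longrightarrow> delta_v M i p s = 0)}"

text \<open>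
  A selection is a total function here, but every notion below depends only on its values on
  \<^const>\<open>price_space\<close>.
\<close>

definition selection :: "real ^ 2 ^ 2 \<Rightarrow> (real ^ firm \<Rightarrow> real ^ 2) \<Rightarrow> bool" where
  "selection M \<sigma> \<longleftrightarrow> (\<forall>p\<in>price_space. \<sigma> p \<in> equilibria M p)"

definition demand :: "(real ^ firm \<Rightarrow> real ^ 2) \<Rightarrow> firm \<Rightarrow> real ^ firm \<Rightarrow> real" where
  "demand \<sigma> j p = (case j of
      Firm_a \<Rightarrow> \<sigma> p $ 1 + \<sigma> p $ 2
    | Firm_b \<Rightarrow> 2 - (\<sigma> p $ 1 + \<sigma> p $ 2))"

definition splits_at :: "(real ^ firm \<Rightarrow> real ^ 2) \<Rightarrow> 2 \<Rightarrow> real ^ firm \<Rightarrow> bool" where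
  "splits_at \<sigma> i p \<longleftrightarrow> 0 < \<sigma> p $ i \<and> \<sigma> p $ i < 1"

definition differentiable_in :: "(real ^ firm \<Rightarrow> real ^ 2) \<Rightarrow> (real ^ firm) set \<Rightarrow> bool" where
  "differentiable_in \<sigma> P \<longleftrightarrow>
     (\<forall>p\<in>P. \<forall>i. (\<lambda>q. \<sigma> q $ i) differentiable (at p within price_space))"

text \<open>
  The partial derivative of firm \<open>j\<close>'s demand in its own price is the derivative of the
  demand along \<open>p\<close> with coordinate \<open>j\<close> replaced by \<open>t\<close>; restricting to \<open>t \<ge> 0\<close>
  makes it one-sided exactly where that price is \<open>0\<close>.
\<close>

definition has_marginal_demand ::
    "(real ^ firm \<Rightarrow> real ^ 2) \<Rightarrow> firm \<Rightarrow> real ^ firm \<Rightarrow> real \<Rightarrow> bool" where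
  "has_marginal_demand \<sigma> j p d \<longleftrightarrow>
     ((\<lambda>t. demand \<sigma> j (\<chi> k. if k = j then t else p $ k)) has_real_derivative d)
       (at (p $ j) within {0..})"

definition negative_marginal_demand_in ::
    "(real ^ firm \<Rightarrow> real ^ 2) \<Rightarrow> (real ^ firm) set \<Rightarrow> bool" where
  "negative_marginal_demand_in \<sigma> P \<longleftrightarrow>
     (\<forall>j. \<forall>p\<in>P. \<exists>d<0. has_marginal_demand \<sigma> j p d)"

definition kappa1 :: "real ^ 2 ^ 2 \<Rightarrow> real" where
  "kappa1 M = (M $ 2 $ 2 - M $ 1 $ 2) / det M"

definition kappa2 :: "real ^ 2 ^ 2 \<Rightarrow> real" where
  "kappa2 M = (M $ 1 $ 1 - M $ 2 $ 1) / det M"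

text \<open>
  The bound is taken in \<^typ>\<open>ereal\<close>, where \<open>1 / 0 = \<infinity>\<close>, as the following shows; over
  \<^typ>\<open>real\<close> one would get \<open>1 / 0 = 0\<close>.
\<close>

definition price_bound :: "real ^ 2 ^ 2 \<Rightarrow> ereal" where
  "price_bound M = min (1 / ereal \<bar>kappa1 M\<bar>) (1 / ereal \<bar>kappa2 M\<bar>)"

lemma one_div_ereal_abs:
  "1 / ereal \<bar>x\<bar> = (if x = 0 then \<infinity> else ereal (1 / \<bar>x\<bar>))"
  by (simp add: divide_ereal_def one_ereal_def inverse_eq_divide)

end

theory Submission imports Defs begin

text \<open>
  If both groups split, indifference is the linear system
  \<open>M (2 \<sigma> - 1) = (p\<^sup>a - p\<^sup>b) (1, 1)\<close>, whose solution is
  \<open>2 \<sigma>\<^sub>i - 1 = \<kappa>\<^sub>i (p\<^sup>a - p\<^sup>b)\<close>; the price bound says exactly that this solution lies in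
  \<open>(0, 1)\<^sup>2\<close>. Conversely, a group that does not split sits at an extreme value, so its derivative
  in \<open>p\<^sup>a\<close> vanishes where \<open>p\<^sup>a > 0\<close>. Negative marginal demand then forces the other group to split
  and to have a negative derivative, whereas differentiating its indifference condition gives a
  nonnegative one. Points with \<open>p\<^sup>a = 0\<close> are reached as limits along the diagonal direction,
  which preserves \<open>p\<^sup>a - p\<^sup>b\<close>.
\<close>

section \<open>Candidate equilibria: both groups indifferent, or all consumers at one firm\<close>

abbreviation price_gap :: "real ^ firm \<Rightarrow> real" where
  "price_gap p \<equiv> p $ Firm_a - p $ Firm_b"

abbreviation set_price :: "firm \<Rightarrow> real ^ firm \<Rightarrow> real \<Rightarrow> real ^ firm" where
  "set_price j p t \<equiv> (\<chi> k. if k = j then t else p $ k)"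

text \<open>It depends on prices only through their gap, and its coordinates may leave
  \<open>[0, 1]\<close>, so it is an equilibrium candidate rather than always an
  equilibrium.\<close>

definition mixed_response :: "real ^ 2 ^ 2 \<Rightarrow> real ^ firm \<Rightarrow> real ^ 2" where
  "mixed_response M p = (\<chi> i. (1 + (if i = 1 then kappa1 M else kappa2 M) * price_gap p) / 2)"

lemma mixed_response_nth [simp]:
  "mixed_response M p $ 1 = (1 + kappa1 M * price_gap p) / 2"
  "mixed_response M p $ 2 = (1 + kappa2 M * price_gap p) / 2"
  by (simp_all add: mixed_response_def)

text \<open>Cramer's rule in \<open>u = 2 * s $ 1 - 1\<close> and \<open>v = 2 * s $ 2 - 1\<close>:
  multiplying by the adjugate of \<open>M\<close> decouples the system, and \<open>det M\<close>
  being nonzero makes this reversible and the solution unique.\<close>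

lemma indifferent_iff_mixed_response:
  assumes "det M \<noteq> 0"
  shows "(\<forall>i. delta_v M i p s = 0) \<longleftrightarrow> s = mixed_response M p"
proof -
  define d x u v where "d = det M" and "x = price_gap p"
    and "u = 2 * s $ 1 - 1" and "v = 2 * s $ 2 - 1"
  define a b c e where "a = M $ 1 $ 1" and "b = M $ 1 $ 2" and "c = M $ 2 $ 1" and "e = M $ 2 $ 2"
  have d: "d = a * e - b * c" "d \<noteq> 0"
    using assms by (simp_all add: d_def a_def b_def c_def e_def det_2)
  have "(\<forall>i. delta_v M i p s = 0) \<longleftrightarrow> a * u + b * v = x \<and> c * u + e * v = x"
    unfolding forall_2 delta_v_def x_def u_def v_def a_def b_def c_def e_def
    by (auto simp: algebra_simps)
  also have "\<dots> \<longleftrightarrow> d * u = (e - b) * x \<and> d * v = (a - c) * x"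
  proof
    assume *: "a * u + b * v = x \<and> c * u + e * v = x"
    have "d * u = e * (a * u + b * v) - b * (c * u + e * v)"
      "d * v = a * (c * u + e * v) - c * (a * u + b * v)"
      by (simp_all add: d(1) algebra_simps)
    with * show "d * u = (e - b) * x \<and> d * v = (a - c) * x"
      by (simp add: algebra_simps)
  next
    assume *: "d * u = (e - b) * x \<and> d * v = (a - c) * x"
    have "d * (a * u + b * v) = a * (d * u) + b * (d * v)"
      "d * (c * u + e * v) = c * (d * u) + e * (d * v)"
      by (simp_all add: algebra_simps)
    then have "d * (a * u + b * v) = d * x" "d * (c * u + e * v) = d * x"
      unfolding *[THEN conjunct1] *[THEN conjunct2] by (simp_all add: d(1) algebra_simps)
    then show "a * u + b * v = x \<and> c * u + e * v = x"
      using d(2) by simp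
  qed
  also have "\<dots> \<longleftrightarrow> u = kappa1 M * x \<and> v = kappa2 M * x"
    using d(2) unfolding kappa1_def kappa2_def d_def[symmetric] a_def[symmetric]
      b_def[symmetric] c_def[symmetric] e_def[symmetric]
    by (simp add: eq_divide_eq mult.commute)
  also have "\<dots> \<longleftrightarrow> s = mixed_response M p"
    by (auto simp: vec_eq_iff forall_2 u_def v_def x_def field_simps)
  finally show ?thesis .
qed

text \<open>A share \<open>(1 + k * x) / 2\<close> is strictly between 0 and 1 exactly when
  \<open>k * x\<close> has absolute value below 1; for \<open>k = 0\<close> the share is one half
  and the bound is infinite.\<close>

lemma mixed_response_splits_iff:
  "(\<forall>i. 0 < mixed_response M p $ i \<and> mixed_response M p $ i < 1) \<longleftrightarrow>
     ereal \<bar>price_gap p\<bar> < price_bound M"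
proof -
  have bound: "ereal \<bar>x\<bar> < 1 / ereal \<bar>k\<bar> \<longleftrightarrow> 0 < (1 + k * x) / 2 \<and> (1 + k * x) / 2 < 1"
    for x k :: real
  proof (cases "k = 0")
    case False
    then have "\<bar>x\<bar> < 1 / \<bar>k\<bar> \<longleftrightarrow> \<bar>k * x\<bar> < 1"
      by (simp add: field_simps abs_mult)
    with False show ?thesis
      by (auto simp: one_div_ereal_abs)
  qed (simp add: one_div_ereal_abs[of 0, unfolded abs_zero])
  show ?thesis
    by (simp only: price_bound_def min_less_iff_conj bound forall_2 mixed_response_nth)
qed

lemma demand_mixed_response:
  assumes "\<sigma> p = mixed_response M p"
  shows "demand \<sigma> j p = 1 + (kappa1 M + kappa2 M) / 2 * (p $ j - p $ other j)"
  using assms by (cases j) (simp_all add: demand_def field_simps)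

text \<open>When everyone joins the weakly cheaper firm, price advantage and network effect point
  the same way. \<open>1\<close> and \<open>0\<close> are constant vectors here. This fills in a
  selection where the price bound fails.\<close>

lemma corner_equilibrium:
  assumes "\<And>i i'. 0 \<le> M $ i $ i'"
  shows "(if price_gap p \<le> 0 then 1 else 0) \<in> equilibria M p"
proof -
  have *: "0 \<le> M $ i $ 1 + M $ i $ 2" for i
    using assms by simp
  then have "p $ Firm_a \<le> p $ Firm_b + (M $ i $ 1 + M $ i $ 2)" if "price_gap p \<le> 0" for i
    using that by (smt (verit))
  moreover have "p $ Firm_b \<le> p $ Firm_a + (M $ i $ 1 + M $ i $ 2)" if "\<not> price_gap p \<le> 0" for i
    using * that by (smt (verit))
  ultimately show ?thesis
    by (auto simp: equilibria_def delta_v_def algebra_simps)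
qed

section \<open>Varying one price while the other is fixed\<close>

lemma eventually_set_price_in:
  assumes "openin (top_of_set price_space) P" "p \<in> P"
  shows "\<forall>\<^sub>F t in at (p $ j) within {0..}. set_price j p t \<in> P"
proof -
  obtain T where T: "open T" "P = price_space \<inter> T"
    using assms(1) by (auto simp: openin_open)
  have "((\<lambda>t. set_price j p t) \<longlongrightarrow> set_price j p (p $ j)) (at (p $ j) within {0..})"
    by (rule tendsto_vec_lambda) (auto intro!: tendsto_eq_intros)
  moreover have "set_price j p (p $ j) = p"
    by (simp add: vec_eq_iff)
  ultimately have "\<forall>\<^sub>F t in at (p $ j) within {0..}. set_price j p t \<in> T"
    using T assms(2) by (intro topological_tendstoD) auto
  moreover have "\<forall>\<^sub>F t in at (p $ j) within {0..}. t \<in> {0..}"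
    by (simp add: eventually_at_filter)
  ultimately show ?thesis
  proof eventually_elim
    case (elim t)
    then show ?case
      using assms(2) T(2) by (auto simp: price_space_def)
  qed
qed

lemma differentiable_along_price:
  fixes f :: "real ^ firm \<Rightarrow> real"
  assumes "f differentiable (at p within price_space)" "p \<in> price_space"
  shows "(\<lambda>t. f (set_price j p t)) differentiable (at (p $ j) within {0..})"
proof -
  have p: "set_price j p (p $ j) = p"
    by (simp add: vec_eq_iff)
  \<comment> \<open>Written as an affine curve, the price path is visibly differentiable, and for
    \<open>t\<close> in \<open>{0..}\<close> it stays in \<open>price_space\<close>, so the chain
    rule applies.\<close>
  have *: "set_price j p = (\<lambda>t. p + (t - p $ j) *\<^sub>R axis j 1)"
    by (auto simp: vec_eq_iff axis_def)
  have "set_price j p differentiable (at (p $ j) within {0..})"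
    unfolding * by (intro derivative_intros)
  moreover have "set_price j p ` {0..} \<subseteq> price_space"
    using assms(2) by (auto simp: price_space_def)
  with assms(1) have "f differentiable (at p within set_price j p ` {0..})"
    by (rule differentiable_within_subset)
  then have "f differentiable (at (set_price j p (p $ j)) within set_price j p ` {0..})"
    by (simp only: p)
  ultimately have "(f \<circ> set_price j p) differentiable (at (p $ j) within {0..})"
    by (rule differentiable_chain_within)
  then show ?thesis
    by (simp only: o_def)
qed

section \<open>Negative marginal demand forces both groups to split\<close>

lemma mixed_response_if_splits:
  assumes "det M \<noteq> 0" "\<sigma> p \<in> equilibria M p" "\<And>i. splits_at \<sigma> i p"
  shows "\<sigma> p = mixed_response M p"
proof -
  have "delta_v M i p (\<sigma> p) = 0" for i
    using assms(2) assms(3)[of i] by (auto simp: equilibria_def splits_at_def)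
  then show ?thesis
    using indifferent_iff_mixed_response[OF assms(1)] by blast
qed

text \<open>Naming the groups \<open>k\<close> and \<open>l\<close> in either order lets one
  argument cover whichever group fails to split.\<close>

lemma delta_v_distinct:
  assumes "k \<noteq> l"
  shows "delta_v M i p s = - price_gap p + M $ i $ k * (2 * s $ k - 1) + M $ i $ l * (2 * s $ l - 1)"
  using assms exhaust_2[of k] exhaust_2[of l] by (auto simp: delta_v_def)

lemma splits_at_if_positive_price:
  assumes nonneg: "\<And>i i'. 0 \<le> M $ i $ i'"
    and "openin (top_of_set price_space) P" "p \<in> P" "0 < p $ Firm_a"
    and sel: "selection M \<sigma>" and "differentiable_in \<sigma> P" "negative_marginal_demand_in \<sigma> P"
  shows "splits_at \<sigma> k p"
proof (rule ccontr)
  assume nk: "\<not> splits_at \<sigma> k p"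
  define t0 f where "t0 = p $ Firm_a" and "f = (\<lambda>i t. \<sigma> (set_price Firm_a p t) $ i)"
  have pP: "p \<in> price_space"
    using assms(2,3) by (auto simp: openin_open)
  \<comment> \<open>A positive price is interior to \<open>{0..}\<close>, so the one-sided
    derivatives become two-sided, as the extremum test requires.\<close>
  have at: "at t0 within {0..} = at t0"
    using assms(4) by (intro at_within_interior) (simp add: t0_def)
  have sp: "set_price Firm_a p t0 = p"
    by (simp add: vec_eq_iff t0_def)
  have eq: "\<sigma> (set_price Firm_a p t) \<in> equilibria M (set_price Firm_a p t)" if "0 \<le> t" for t
    using sel that pP by (auto simp: selection_def price_space_def)
  have range: "0 \<le> f i t \<and> f i t \<le> 1" if "0 \<le> t" for i t
    using eq[OF that] by (auto simp: f_def equilibria_def)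
  have "\<exists>D. (f i has_real_derivative D) (at t0)" for i
  proof -
    have "(\<lambda>q. \<sigma> q $ i) differentiable (at p within price_space)"
      using assms(3,6) by (auto simp: differentiable_in_def)
    from differentiable_along_price[OF this pP, of Firm_a] show ?thesis
      unfolding real_differentiable_def f_def t0_def[symmetric] at .
  qed
  then have "\<forall>i. \<exists>D. (f i has_real_derivative D) (at t0)"
    by blast
  then obtain D where D: "\<And>i. (f i has_real_derivative D i) (at t0)"
    unfolding choice_iff by blast
  \<comment> \<open>Fermat's rule: the share of a group that does not split is 0 or 1, the least or
    greatest value possible. The radius \<open>t0\<close> keeps the varied price
    nonnegative.\<close>
  have D0: "D i = 0" if "\<not> splits_at \<sigma> i p" for i
  proof -
    have t0: "0 < t0" using assms(4) by (simp add: t0_def)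
    have near: "0 \<le> f i t \<and> f i t \<le> 1" if "\<bar>t0 - t\<bar> < t0" for t
    proof (rule range)
      show "0 \<le> t"
        using that by linarith
    qed
    have "f i t0 = 0 \<or> f i t0 = 1"
      using that range[of t0 i] t0 by (auto simp: f_def sp splits_at_def)
    then show ?thesis
    proof
      assume "f i t0 = 0"
      then have "\<forall>t. \<bar>t0 - t\<bar> < t0 \<longrightarrow> f i t0 \<le> f i t"
        using near by metis
      with D t0 show ?thesis
        by (rule DERIV_local_min)
    next
      assume "f i t0 = 1"
      then have "\<forall>t. \<bar>t0 - t\<bar> < t0 \<longrightarrow> f i t \<le> f i t0"
        using near by metis
      with D t0 show ?thesis
        by (rule DERIV_local_max)
    qed
  qed
  have "(1::2) \<noteq> 2"
    by simp
  then obtain l where l: "k \<noteq> l"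
    by metis
  have "demand \<sigma> Firm_a q = \<sigma> q $ k + \<sigma> q $ l" for q
    using l exhaust_2[of k] exhaust_2[of l] by (auto simp: demand_def)
  then have sum: "demand \<sigma> Firm_a (set_price Firm_a p t) = f k t + f l t" for t
    by (simp add: f_def)
  obtain d where d: "d < 0" "has_marginal_demand \<sigma> Firm_a p d"
    using assms(3,7) by (auto simp: negative_marginal_demand_in_def)
  have "((\<lambda>t. f k t + f l t) has_real_derivative d) (at t0)"
    using d(2) unfolding has_marginal_demand_def sum t0_def[symmetric] at .
  moreover have "((\<lambda>t. f k t + f l t) has_real_derivative (D k + D l)) (at t0)"
    by (intro DERIV_add D)
  ultimately have "D k + D l = d"
    using DERIV_unique by blast
  \<comment> \<open>Group \<open>k\<close> contributes slope 0, so the whole negative slope of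
    demand falls on group \<open>l\<close>, which must then split by \<open>D0\<close>.\<close>
  then have Dl: "D l < 0"
    using D0[OF nk] d(1) by simp
  then have "splits_at \<sigma> l p"
    using D0[of l] by linarith
  then have l0: "0 < f l t0" "f l t0 < 1"
    by (simp_all add: splits_at_def f_def sp)
  \<comment> \<open>Continuity keeps group \<open>l\<close> splitting near \<open>t0\<close>, so its
    indifference condition holds on a whole neighbourhood and may be differentiated.\<close>
  have "filterlim (f l) (nhds (f l t0)) (nhds t0)"
    using D[of l] by (metis DERIV_isCont isCont_def tendsto_at_iff_tendsto_nhds)
  note lim = order_tendstoD[OF this]
  have "\<forall>\<^sub>F t in nhds t0. t \<in> {0<..}"
    using assms(4) by (intro eventually_nhds_in_open) (auto simp: t0_def)
  with lim(1)[OF l0(1)] lim(2)[OF l0(2)]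
  have "\<forall>\<^sub>F t in nhds t0. t - p $ Firm_b = M $ l $ k * (2 * f k t - 1) + M $ l $ l * (2 * f l t - 1)"
  proof eventually_elim
    case (elim t)
    then have "delta_v M l (set_price Firm_a p t) (\<sigma> (set_price Firm_a p t)) = 0"
      using eq[of t] by (auto simp: equilibria_def f_def)
    then show ?case
      by (simp add: delta_v_distinct[OF l] f_def)
  qed
  moreover have "((\<lambda>t. t - p $ Firm_b) has_real_derivative 1) (at t0)"
    by (auto intro!: derivative_eq_intros)
  ultimately have "((\<lambda>t. M $ l $ k * (2 * f k t - 1) + M $ l $ l * (2 * f l t - 1)) has_real_derivative 1) (at t0)"
    by (rule DERIV_cong_ev[OF refl _ refl, THEN iffD1])
  moreover have "((\<lambda>t. M $ l $ k * (2 * f k t - 1) + M $ l $ l * (2 * f l t - 1)) has_real_derivative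
      M $ l $ k * (2 * D k - 0) + M $ l $ l * (2 * D l - 0)) (at t0)"
    by (intro DERIV_add DERIV_cmult DERIV_diff DERIV_const D)
  ultimately have "M $ l $ k * (2 * D k - 0) + M $ l $ l * (2 * D l - 0) = 1"
    using DERIV_unique by blast
  \<comment> \<open>With \<open>D k = 0\<close> only the effect of group \<open>l\<close> on itself
    remains: the unit slope of the price gap equals twice a product of a nonnegative entry and a
    negative slope.\<close>
  then have "2 * (M $ l $ l * D l) = 1"
    by (simp add: D0[OF nk])
  moreover have "M $ l $ l * D l \<le> 0"
    using nonneg[of l l] Dl by (simp add: mult_nonneg_nonpos)
  ultimately show False
    by linarith
qed

lemma splits_mixed_response:
  assumes "\<And>i i'. 0 \<le> M $ i $ i'" "det M \<noteq> 0"
    and "openin (top_of_set price_space) P" "p \<in> P"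
    and "selection M \<sigma>" "differentiable_in \<sigma> P" "negative_marginal_demand_in \<sigma> P"
  shows "\<sigma> p = mixed_response M p" "splits_at \<sigma> i p"
proof -
  \<comment> \<open>Raising both prices by \<open>t\<close> keeps the gap, hence the mixed response,
    and makes the price of \<open>Firm_a\<close> positive even if it was 0.\<close>
  define q :: "real \<Rightarrow> real ^ firm" where "q t = (\<chi> k. p $ k + t)" for t
  obtain T where T: "open T" "P = price_space \<inter> T"
    using assms(3) by (auto simp: openin_open)
  have "(q \<longlongrightarrow> q 0) (at_right 0)"
    unfolding q_def by (rule tendsto_vec_lambda) (auto intro!: tendsto_eq_intros)
  moreover have "q 0 = p"
    by (simp add: q_def vec_eq_iff)
  ultimately have q: "(q \<longlongrightarrow> p) (at_right 0)"
    by simp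
  have pos: "\<forall>\<^sub>F t in at_right 0. 0 < (t::real)"
    by (simp add: eventually_at_right_less)
  have "\<forall>\<^sub>F t in at_right 0. q t \<in> T"
    using q T assms(4) by (intro topological_tendstoD) auto
  with pos have near: "\<forall>\<^sub>F t in at_right 0. q t \<in> P \<and> 0 < q t $ Firm_a \<and> q t \<noteq> p"
  proof eventually_elim
    case (elim t)
    then show ?case
      using assms(4) T(2)
      by (auto simp: price_space_def q_def vec_eq_iff intro: add_nonneg_nonneg add_nonneg_pos)
  qed
  have mixed: "\<sigma> (q t) = mixed_response M p \<and> (\<forall>i. splits_at \<sigma> i (q t))"
    if t: "q t \<in> P \<and> 0 < q t $ Firm_a \<and> q t \<noteq> p" for t
  proof -
    have split: "splits_at \<sigma> i (q t)" for i
      using splits_at_if_positive_price[OF assms(1,3) _ _ assms(5,6,7)] t by blast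
    moreover have "\<sigma> (q t) \<in> equilibria M (q t)"
      using assms(5) t T(2) by (auto simp: selection_def)
    ultimately have "\<sigma> (q t) = mixed_response M (q t)"
      using mixed_response_if_splits assms(2) by blast
    also have "mixed_response M (q t) = mixed_response M p"
      by (simp add: mixed_response_def q_def)
    finally show ?thesis
      using split by blast
  qed
  have "filterlim q (at p within price_space) (at_right 0)"
    unfolding filterlim_at using q near T(2) by (auto elim: eventually_mono)
  \<comment> \<open>Along \<open>q\<close> the selection is eventually constant, equal to the mixed
    response at \<open>p\<close>; continuity of the selection at \<open>p\<close> carries this value
    to the limit.\<close>
  have "\<sigma> p $ i = mixed_response M p $ i" for i
  proof (rule tendsto_unique[of "at_right (0::real)"])
    have "continuous (at p within price_space) (\<lambda>q. \<sigma> q $ i)"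
      using assms(4,6) by (auto simp: differentiable_in_def intro: differentiable_imp_continuous_within)
    then show "((\<lambda>t. \<sigma> (q t) $ i) \<longlongrightarrow> \<sigma> p $ i) (at_right 0)"
      unfolding continuous_within
      using \<open>filterlim q (at p within price_space) (at_right 0)\<close> by (rule filterlim_compose)
    have "\<forall>\<^sub>F t in at_right 0. \<sigma> (q t) $ i = mixed_response M p $ i"
      using near by eventually_elim (simp add: mixed)
    then show "((\<lambda>t. \<sigma> (q t) $ i) \<longlongrightarrow> mixed_response M p $ i) (at_right 0)"
      by (rule tendsto_eventually)
  qed simp
  then show eq: "\<sigma> p = mixed_response M p"
    by (simp add: vec_eq_iff)
  \<comment> \<open>Strict splitting need not survive a limit; it holds at \<open>p\<close> because
    the value there coincides with the value at a nearby \<open>q t\<close>.\<close>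
  obtain t where "q t \<in> P \<and> 0 < q t $ Firm_a \<and> q t \<noteq> p"
    using eventually_happens'[OF _ near] by auto
  with mixed eq show "splits_at \<sigma> i p"
    by (metis splits_at_def)
qed

section \<open>Marginal demand and differentiability where the mixed response is played\<close>

lemma has_marginal_demand_mixed_response:
  assumes "openin (top_of_set price_space) P" "p \<in> P"
    and mixed: "\<And>q. q \<in> P \<Longrightarrow> \<sigma> q = mixed_response M q"
  shows "has_marginal_demand \<sigma> j p ((kappa1 M + kappa2 M) / 2)"
proof -
  let ?f = "\<lambda>t. 1 + (kappa1 M + kappa2 M) / 2 * (t - p $ other j)"
  have other: "other j \<noteq> j"
    by (cases j) auto
  have eq: "demand \<sigma> j (set_price j p t) = ?f t" if "set_price j p t \<in> P" for t
    using demand_mixed_response[of \<sigma> "set_price j p t" M j, OF mixed[OF that]] other by simp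
  have "set_price j p (p $ j) = p"
    by (simp add: vec_eq_iff)
  \<comment> \<open>The filter \<open>at\<close> omits its base point, so agreement there is
    supplied separately for the derivative congruence.\<close>
  then have "demand \<sigma> j (set_price j p (p $ j)) = ?f (p $ j)"
    using eq[of "p $ j"] assms(2) by metis
  moreover have "\<forall>\<^sub>F t in at (p $ j) within {0..}. demand \<sigma> j (set_price j p t) = ?f t"
    using eventually_set_price_in[OF assms(1,2)] by eventually_elim (rule eq)
  moreover have "(?f has_real_derivative (kappa1 M + kappa2 M) / 2) (at (p $ j) within {0..})"
    by (auto intro!: derivative_eq_intros)
  ultimately show ?thesis
    unfolding has_marginal_demand_def
    by (simp only: has_field_derivative_cong_eventually[where g = ?f])
qed

text \<open>To the right of a nonnegative price there is always room inside \<open>{0..}\<close>, so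
  the filter is nontrivial even at price 0.\<close>

lemma has_marginal_demand_unique:
  assumes "p \<in> price_space" "has_marginal_demand \<sigma> j p d" "has_marginal_demand \<sigma> j p d'"
  shows "d = d'"
proof -
  have "at_right (p $ j) \<le> at (p $ j) within {0..}"
    using assms(1) by (intro at_le) (auto simp: price_space_def intro: order_trans less_imp_le)
  then have "at (p $ j) within {0..} \<noteq> bot"
    by (metis bot.extremum_unique trivial_limit_at_right_real)
  then show ?thesis
    using assms(2,3) unfolding has_marginal_demand_def by (rule has_field_derivative_unique[rotated 2])
qed

lemma differentiable_vec_nth: "(\<lambda>x. x $ i) differentiable F"
  by (intro bounded_linear_imp_differentiable bounded_linear_vec_nth)

lemma differentiable_in_mixed_response:
  assumes "openin (top_of_set price_space) P"
    and mixed: "\<And>q. q \<in> P \<Longrightarrow> \<sigma> q = mixed_response M q"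
  shows "differentiable_in \<sigma> P"
  unfolding differentiable_in_def
proof (intro ballI allI)
  fix p i
  assume p: "p \<in> P"
  obtain T where T: "open T" "P = price_space \<inter> T"
    using assms(1) by (auto simp: openin_open)
  obtain r where r: "r > 0" "ball p r \<subseteq> T"
    using T p by (auto elim: openE)
  have "(\<lambda>q. mixed_response M q $ i) differentiable (at p within price_space)"
    unfolding mixed_response_def
    by (auto intro!: derivative_intros differentiable_vec_nth)
  then show "(\<lambda>q. \<sigma> q $ i) differentiable (at p within price_space)"
    using r T(2) p mixed
    by (elim differentiable_transform_within) (auto simp: dist_commute subset_eq)
qed

section \<open>Equivalence with the price bound, and the induced demand\<close>

theorem lemma1:
  fixes M :: "real ^ 2 ^ 2" and P :: "(real ^ firm) set"
  assumes "\<And>i i'. 0 \<le> M $ i $ i'"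
    and "det M \<noteq> 0"
    and "openin (top_of_set price_space) P"
    and "P \<noteq> {}"
  shows "((\<exists>\<sigma>. selection M \<sigma> \<and> differentiable_in \<sigma> P \<and> negative_marginal_demand_in \<sigma> P)
           \<longleftrightarrow> kappa1 M + kappa2 M < 0 \<and>
               (\<forall>p\<in>P. ereal \<bar>p $ Firm_a - p $ Firm_b\<bar> < price_bound M))
       \<and> (\<forall>\<sigma>. selection M \<sigma> \<and> differentiable_in \<sigma> P \<and> negative_marginal_demand_in \<sigma> P \<longrightarrow>
            (\<forall>p\<in>P. (\<forall>i. splits_at \<sigma> i p) \<and>
               (\<forall>j. demand \<sigma> j p = 1 + (kappa1 M + kappa2 M) / 2 * (p $ j - p $ other j))))"
proof (intro conjI iffI allI impI ballI)
  assume "\<exists>\<sigma>. selection M \<sigma> \<and> differentiable_in \<sigma> P \<and> negative_marginal_demand_in \<sigma> P"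
  then obtain \<sigma> where \<sigma>: "selection M \<sigma>" "differentiable_in \<sigma> P" "negative_marginal_demand_in \<sigma> P"
    by blast
  note mixed = splits_mixed_response[OF assms(1,2,3) _ \<sigma>]
  obtain p where p: "p \<in> P"
    using assms(4) by blast
  \<comment> \<open>Uniqueness of the marginal demand identifies this negative \<open>d\<close> with
    \<open>(kappa1 M + kappa2 M) / 2\<close>.\<close>
  then obtain d where "d < 0" "has_marginal_demand \<sigma> Firm_a p d"
    using \<sigma>(3) by (auto simp: negative_marginal_demand_in_def)
  moreover have "has_marginal_demand \<sigma> Firm_a p ((kappa1 M + kappa2 M) / 2)"
    using assms(3) p mixed(1) by (rule has_marginal_demand_mixed_response)
  moreover have "p \<in> price_space"
    using p assms(3) by (auto simp: openin_open)
  ultimately have "(kappa1 M + kappa2 M) / 2 < 0"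
    using has_marginal_demand_unique by metis
  then show "kappa1 M + kappa2 M < 0"
    by simp
  show "ereal \<bar>p $ Firm_a - p $ Firm_b\<bar> < price_bound M" if "p \<in> P" for p
    using mixed(2)[OF that] mixed_response_splits_iff[of M p]
    by (simp add: splits_at_def mixed(1)[OF that])
next
  assume *: "kappa1 M + kappa2 M < 0 \<and> (\<forall>p\<in>P. ereal \<bar>p $ Firm_a - p $ Firm_b\<bar> < price_bound M)"
  \<comment> \<open>The case split is on the price bound, which holds throughout \<open>P\<close>:
    there the mixed response is played, while corner equilibria complete the selection
    elsewhere.\<close>
  define \<sigma> where "\<sigma> p = (if ereal \<bar>price_gap p\<bar> < price_bound M then mixed_response M p
    else if price_gap p \<le> 0 then 1 else 0)" for p
  have mixed: "\<sigma> p = mixed_response M p" if "p \<in> P" for p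
    using * that by (simp add: \<sigma>_def)
  have "\<sigma> p \<in> equilibria M p" for p
  proof (cases "ereal \<bar>price_gap p\<bar> < price_bound M")
    case True
    then have "0 < mixed_response M p $ i" "mixed_response M p $ i < 1" for i
      using mixed_response_splits_iff by blast+
    moreover have "delta_v M i p (mixed_response M p) = 0" for i
      using indifferent_iff_mixed_response[OF assms(2)] by blast
    ultimately show ?thesis
      using True by (simp add: \<sigma>_def equilibria_def less_imp_le)
  next
    case False
    then show ?thesis
      using corner_equilibrium[OF assms(1)] by (simp add: \<sigma>_def)
  qed
  then have "selection M \<sigma>"
    by (simp add: selection_def)
  moreover have "differentiable_in \<sigma> P"
    using assms(3) mixed by (rule differentiable_in_mixed_response)
  moreover have "has_marginal_demand \<sigma> j p ((kappa1 M + kappa2 M) / 2)" if "p \<in> P" for j p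
    using assms(3) that mixed by (rule has_marginal_demand_mixed_response)
  then have "negative_marginal_demand_in \<sigma> P"
    using * unfolding negative_marginal_demand_in_def
    by (intro allI ballI exI[of _ "(kappa1 M + kappa2 M) / 2"]) simp
  ultimately show "\<exists>\<sigma>. selection M \<sigma> \<and> differentiable_in \<sigma> P \<and> negative_marginal_demand_in \<sigma> P"
    by blast
next
  fix \<sigma> p
  assume \<sigma>: "selection M \<sigma> \<and> differentiable_in \<sigma> P \<and> negative_marginal_demand_in \<sigma> P"
    and "p \<in> P"
  then have mixed: "\<sigma> p = mixed_response M p" "splits_at \<sigma> i p" for i
    using splits_mixed_response[OF assms(1,2,3)] by blast+
  show "splits_at \<sigma> i p" for i
    by (fact mixed)
  show "demand \<sigma> j p = 1 + (kappa1 M + kappa2 M) / 2 * (p $ j - p $ other j)" for j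
    using mixed(1) by (rule demand_mixed_response)
qed

end
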